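(* Let $n\ge 1$ and let $\delta: sl_{n+1}(\mathbf{C})\to sl_{n+1}(\mathbf{C})\otimes sl_{n+1}(\mathbf{C})$ be the linear map given by $$\delta(E_{i,j})=\frac{1}{2n+2}\sum_{k=1}^{n+1}\left(E_{i,k}\otimes E_{k,j}-E_{k,j}\otimes E_{i,k}\right),\qquad 1\le i,j\le n+1.$$ Then $(sl_{n+1}(\mathbf{C}),[\cdot,\cdot],\delta)$, where $[\cdot,\cdot]$ is the commutator bracket, is a co-split Lie algebra.
   Context: $E_{i,j}$ denotes the matrix units, and $sl_{n+1}(\mathbf{C})$ is the Lie algebra of traceless complex $(n+1)\times(n+1)$ matrices, with bracket $[E_{i,j},E_{k,l}]=\delta_{j,k}E_{i,l}-\delta_{l,i}E_{k,j}$ (Kronecker deltas). The formula for $\delta$ is extended linearly to all matrices in $gl_{n+1}(\mathbf{C})$ and then restricted to $sl_{n+1}(\mathbf{C})$; this restriction takes values in $sl_{n+1}(\mathbf{C})\otimes sl_{n+1}(\mathbf{C})$. A Lie coalgebra is a pair $(L,\delta)$ with $L$ a vector space and $\delta:L\to L\otimes L$ a linear map such that $(1+\tau)\circ\delta=0$ and $(1+\xi+\xi^2)\circ(1\otimes\delta)\circ\delta=0$, where $\tau(u\otimes v)=v\otimes u$ and $\xi(u\otimes v\otimes w)=v\otimes w\otimes u$. A triple $(L,[\cdot,\cdot],\delta)$ is a co-split Lie algebra if $(L,[\cdot,\cdot])$ is a Lie algebra, $(L,\delta)$ is a Lie coalgebra, and $[\cdot,\cdot]\circ\delta=\mathrm{id}_L$,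 where $[\cdot,\cdot]$ is regarded as a linear map $L\otimes L\to L$. *)

theory Defs
  imports "HOL-Analysis.Analysis" "HOL-Library.Poly_Mapping"
begin

section \<open>Complex vector spaces\<close>

class complex_vector = ab_group_add +
  fixes scaleC :: "complex \<Rightarrow> 'a \<Rightarrow> 'a"  (infixr "*\<^sub>C" 75)
  assumes scaleC_add_right: "a *\<^sub>C (x + y) = a *\<^sub>C x + a *\<^sub>C y"
    and scaleC_add_left: "(a + b) *\<^sub>C x = a *\<^sub>C x + b *\<^sub>C x"
    and scaleC_scaleC: "a *\<^sub>C b *\<^sub>C x = (a * b) *\<^sub>C x"
    and scaleC_one: "1 *\<^sub>C x = x"

interpretation complex_vector: vector_space "scaleC :: complex \<Rightarrow> 'a \<Rightarrow> 'a::complex_vector"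
  by unfold_locales (fact scaleC_add_right scaleC_add_left scaleC_scaleC scaleC_one)+

abbreviation clinear :: "('a::complex_vector \<Rightarrow> 'b::complex_vector) \<Rightarrow> bool"
  where "clinear \<equiv> Vector_Spaces.linear scaleC scaleC"

definition cbilinear :: "('a::complex_vector \<Rightarrow> 'b::complex_vector \<Rightarrow> 'c::complex_vector) \<Rightarrow> bool"
  where "cbilinear f \<longleftrightarrow> (\<forall>u. clinear (f u)) \<and> (\<forall>v. clinear (\<lambda>u. f u v))"

lemma clinear_iff:
  "clinear f \<longleftrightarrow> (\<forall>x y. f (x + y) = f x + f y) \<and> (\<forall>c x. f (c *\<^sub>C x) = c *\<^sub>C f x)"
  by (auto simp: Vector_Spaces.linear_def module_hom_def module_hom_axioms_def
      complex_vector.vector_space_axioms complex_vector.module_axioms)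

lemma cbilinear_iff:
  "cbilinear f \<longleftrightarrow>
     (\<forall>u u' v. f (u + u') v = f u v + f u' v) \<and> (\<forall>u v v'. f u (v + v') = f u v + f u v') \<and>
     (\<forall>c u v. f (c *\<^sub>C u) v = c *\<^sub>C f u v) \<and> (\<forall>c u v. f u (c *\<^sub>C v) = c *\<^sub>C f u v)"
  by (auto simp: cbilinear_def clinear_iff)

lemma clinear_add: "clinear f \<Longrightarrow> f (x + y) = f x + f y"
  and clinear_scale: "clinear f \<Longrightarrow> f (c *\<^sub>C x) = c *\<^sub>C f x"
  by (auto simp: clinear_iff)

lemma clinear_compose: "clinear f \<Longrightarrow> clinear g \<Longrightarrow> clinear (g \<circ> f)"
  by (simp add: clinear_iff)

lemma clinear_0: "clinear f \<Longrightarrow> f 0 = 0"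
  by (rule module_hom.zero[of scaleC scaleC]) (simp add: module_hom_iff_linear)

lemma clinear_diff: "clinear f \<Longrightarrow> f (x - y) = f x - f y"
  by (rule module_hom.diff[of scaleC scaleC]) (simp add: module_hom_iff_linear)

lemma clinear_sum: "clinear f \<Longrightarrow> f (\<Sum>i\<in>I. g i) = (\<Sum>i\<in>I. f (g i))"
  by (rule module_hom.sum[of scaleC scaleC]) (simp add: module_hom_iff_linear)

instantiation complex :: complex_vector
begin
definition scaleC_complex_def: "(a :: complex) *\<^sub>C (x :: complex) = a * x"
instance by standard (simp_all add: scaleC_complex_def algebra_simps)
end

instantiation vec :: (complex_vector, finite) complex_vector
begin
definition scaleC_vec_def: "a *\<^sub>C x = (\<chi> i. a *\<^sub>C (x $ i))"
instance
  by standard (simp_all add: scaleC_vec_def vec_eq_iff scaleC_add_right scaleC_add_left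
      scaleC_scaleC scaleC_one)
end

lemma scaleC_vec_nth [simp]: "(a *\<^sub>C x) $ i = a *\<^sub>C (x $ i)"
  by (simp add: scaleC_vec_def)

instantiation poly_mapping :: (type, complex_vector) complex_vector
begin
lift_definition scaleC_poly_mapping :: "complex \<Rightarrow> ('a \<Rightarrow>\<^sub>0 'b) \<Rightarrow> ('a \<Rightarrow>\<^sub>0 'b)"
  is "\<lambda>c f x. c *\<^sub>C f x"
  by (erule rev_finite_subset) (auto simp: complex_vector.scale_zero_right)
instance
  by standard (transfer, simp add: scaleC_add_right scaleC_add_left scaleC_scaleC scaleC_one)+
end

lemma lookup_scaleC: "Poly_Mapping.lookup (c *\<^sub>C p) x = c *\<^sub>C Poly_Mapping.lookup p x"
  by transfer simp


section \<open>Tensor products over \<open>\<complex>\<close>\<close>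

text \<open>
  The tensor product is the free complex vector space on \<open>'a \<times> 'b\<close>, that is
  \<open>'a \<times> 'b \<Rightarrow>\<^sub>0 complex\<close>, modulo the span of the bilinearity relators.
\<close>

definition tensor_relators :: "('a::complex_vector \<times> 'b::complex_vector \<Rightarrow>\<^sub>0 complex) set" where
  "tensor_relators =
     {Poly_Mapping.single (u + u', v) 1 - Poly_Mapping.single (u, v) 1
        - Poly_Mapping.single (u', v) 1 | u u' v. True}
   \<union> {Poly_Mapping.single (u, v + v') 1 - Poly_Mapping.single (u, v) 1
        - Poly_Mapping.single (u, v') 1 | u v v'. True}
   \<union> {Poly_Mapping.single (c *\<^sub>C u, v) 1 - c *\<^sub>C Poly_Mapping.single (u, v) 1 | c u v. True}
   \<union> {Poly_Mapping.single (u, c *\<^sub>C v) 1 - c *\<^sub>C Poly_Mapping.single (u, v) 1 | c u v. True}"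

definition tensor_rel ::
    "('a::complex_vector \<times> 'b::complex_vector \<Rightarrow>\<^sub>0 complex) \<Rightarrow> ('a \<times> 'b \<Rightarrow>\<^sub>0 complex) \<Rightarrow> bool"
  where "tensor_rel p q \<longleftrightarrow> p - q \<in> complex_vector.span tensor_relators"

lemma equivp_tensor_rel: "equivp tensor_rel"
proof (rule equivpI)
  show "reflp tensor_rel"
    by (simp add: reflp_def tensor_rel_def complex_vector.span_zero)
  show "symp tensor_rel"
    unfolding symp_def tensor_rel_def
    by (metis complex_vector.span_neg minus_diff_eq)
  show "transp tensor_rel"
    unfolding transp_def tensor_rel_def
    by (metis (no_types, opaque_lifting) complex_vector.span_add diff_add_cancel add_diff_eq)
qed

quotient_type (overloaded) ('a, 'b) tensor =
    "'a::complex_vector \<times> 'b::complex_vector \<Rightarrow>\<^sub>0 complex" / tensor_rel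
  by (rule equivp_tensor_rel)

instantiation tensor :: (complex_vector, complex_vector) complex_vector
begin

lift_definition zero_tensor :: "('a, 'b) tensor" is 0 .

lift_definition plus_tensor :: "('a, 'b) tensor \<Rightarrow> ('a, 'b) tensor \<Rightarrow> ('a, 'b) tensor" is "(+)"
  unfolding tensor_rel_def by (metis add_diff_add complex_vector.span_add)

lift_definition minus_tensor :: "('a, 'b) tensor \<Rightarrow> ('a, 'b) tensor \<Rightarrow> ('a, 'b) tensor" is "(-)"
proof -
  fix p p' q q' :: "'a \<times> 'b \<Rightarrow>\<^sub>0 complex"
  assume "tensor_rel p p'" "tensor_rel q q'"
  moreover have "p - q - (p' - q') = (p - p') - (q - q')"
    by simp
  ultimately show "tensor_rel (p - q) (p' - q')"
    unfolding tensor_rel_def by (metis complex_vector.span_diff)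
qed

lift_definition uminus_tensor :: "('a, 'b) tensor \<Rightarrow> ('a, 'b) tensor" is uminus
  unfolding tensor_rel_def
  by (metis complex_vector.span_neg minus_diff_minus)

lift_definition scaleC_tensor :: "complex \<Rightarrow> ('a, 'b) tensor \<Rightarrow> ('a, 'b) tensor" is scaleC
  unfolding tensor_rel_def
  by (metis complex_vector.span_scale complex_vector.scale_right_diff_distrib)

instance
proof
  fix x y z :: "('a, 'b) tensor" and a b :: complex
  have eqD: "tensor_rel p q" if "p = q" for p q :: "'a \<times> 'b \<Rightarrow>\<^sub>0 complex"
    using that by (simp add: tensor_rel_def complex_vector.span_zero)
  show "x + y + z = x + (y + z)" by transfer (rule eqD, simp add: algebra_simps)
  show "x + y = y + x" by transfer (rule eqD, simp add: algebra_simps)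
  show "0 + x = x" by transfer (rule eqD, simp)
  show "- x + x = 0" by transfer (rule eqD, simp)
  show "x - y = x + - y" by transfer (rule eqD, simp)
  show "a *\<^sub>C (x + y) = a *\<^sub>C x + a *\<^sub>C y" by transfer (rule eqD, simp add: scaleC_add_right)
  show "(a + b) *\<^sub>C x = a *\<^sub>C x + b *\<^sub>C x" by transfer (rule eqD, simp add: scaleC_add_left)
  show "a *\<^sub>C b *\<^sub>C x = (a * b) *\<^sub>C x" by transfer (rule eqD, simp add: scaleC_scaleC)
  show "1 *\<^sub>C x = x" by transfer (rule eqD, simp add: scaleC_one)
qed

end

lift_definition tensor_of :: "'a::complex_vector \<Rightarrow> 'b::complex_vector \<Rightarrow> ('a, 'b) tensor"
    (infixr "\<otimes>" 75)
  is "\<lambda>u v. Poly_Mapping.single (u, v) 1" .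

text \<open>
  The linear map \<open>'a \<otimes> 'b \<rightarrow> 'c\<close> induced by a bilinear map \<open>f\<close>. It is computed on a chosen
  representative; for bilinear \<open>f\<close> the choice is irrelevant (\<open>tensor_lift_abs\<close> below), for
  other \<open>f\<close> the value is meaningless.
\<close>

definition free_extend ::
    "('a \<Rightarrow> 'b \<Rightarrow> 'c::complex_vector) \<Rightarrow> ('a \<times> 'b \<Rightarrow>\<^sub>0 complex) \<Rightarrow> 'c"
  where "free_extend f p = (\<Sum>(u, v)\<in>Poly_Mapping.keys p. Poly_Mapping.lookup p (u, v) *\<^sub>C f u v)"

definition tensor_lift ::
    "('a::complex_vector \<Rightarrow> 'b::complex_vector \<Rightarrow> 'c::complex_vector) \<Rightarrow> ('a, 'b) tensor \<Rightarrow> 'c"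
  where "tensor_lift f t = free_extend f (rep_tensor t)"

lemma free_extend_superset:
  assumes "finite S" "Poly_Mapping.keys p \<subseteq> S"
  shows "free_extend f p = (\<Sum>(u, v)\<in>S. Poly_Mapping.lookup p (u, v) *\<^sub>C f u v)"
  unfolding free_extend_def
  using assms by (intro sum.mono_neutral_left) (auto simp: in_keys_iff complex_vector.scale_zero_left)

lemma clinear_free_extend: "clinear (free_extend f)"
proof -
  have "free_extend f (p + q) = free_extend f p + free_extend f q" for p q
  proof -
    let ?S = "Poly_Mapping.keys p \<union> Poly_Mapping.keys q"
    have "free_extend f r = (\<Sum>(u, v)\<in>?S. Poly_Mapping.lookup r (u, v) *\<^sub>C f u v)"
      if "r \<in> {p, q, p + q}" for r
      using that Poly_Mapping.keys_add[of p q] by (intro free_extend_superset) auto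
    then show ?thesis
      by (simp add: lookup_add scaleC_add_left case_prod_unfold sum.distrib)
  qed
  moreover have "free_extend f (c *\<^sub>C p) = c *\<^sub>C free_extend f p" for c p
  proof -
    have "Poly_Mapping.keys (c *\<^sub>C p) \<subseteq> Poly_Mapping.keys p"
      by (auto simp: in_keys_iff lookup_scaleC complex_vector.scale_zero_right)
    then have "free_extend f (c *\<^sub>C p) =
        (\<Sum>(u, v)\<in>Poly_Mapping.keys p. Poly_Mapping.lookup (c *\<^sub>C p) (u, v) *\<^sub>C f u v)"
      by (intro free_extend_superset) auto
    then show ?thesis
      by (simp add: free_extend_def lookup_scaleC scaleC_complex_def scaleC_scaleC
          complex_vector.scale_sum_right case_prod_unfold)
  qed
  ultimately show ?thesis by (simp add: clinear_iff)
qed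

lemma free_extend_single [simp]: "free_extend f (Poly_Mapping.single (u, v) 1) = f u v"
  by (simp add: free_extend_def scaleC_one)

lemma free_extend_cong:
  assumes "cbilinear f" "tensor_rel p q"
  shows "free_extend f p = free_extend f q"
proof -
  note lin = clinear_free_extend[of f]
  have hom: "module_hom scaleC scaleC (free_extend f)"
    using lin by (simp add: module_hom_iff_linear)
  have "free_extend f r = 0" if "r \<in> tensor_relators" for r
    using that assms(1) unfolding tensor_relators_def
    by (auto simp: clinear_diff[OF lin] module_hom.scale[OF hom] cbilinear_iff)
  then have "free_extend f (p - q) = 0"
    using module_hom.eq_0_on_span[OF hom, of tensor_relators] assms(2)
    by (auto simp: tensor_rel_def)
  then show ?thesis by (simp add: clinear_diff[OF lin])
qed

lemma tensor_lift_abs: "cbilinear f \<Longrightarrow> tensor_lift f (abs_tensor p) = free_extend f p"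
  unfolding tensor_lift_def
  by (erule free_extend_cong)
    (simp add: Quotient3_abs_rep[OF Quotient3_tensor] flip: tensor.abs_eq_iff)

lemma tensor_lift_tensor_of: "cbilinear f \<Longrightarrow> tensor_lift f (u \<otimes> v) = f u v"
  by (simp add: tensor_of.abs_eq tensor_lift_abs)

lemma clinear_tensor_lift:
  assumes "cbilinear f" shows "clinear (tensor_lift f)"
proof -
  note lin = clinear_free_extend[of f, unfolded clinear_iff]
  have "tensor_lift f (s + t) = tensor_lift f s + tensor_lift f t" for s t
    by (induct s, induct t) (simp add: plus_tensor.abs_eq tensor_lift_abs assms lin)
  moreover have "tensor_lift f (c *\<^sub>C s) = c *\<^sub>C tensor_lift f s" for c s
    by (induct s) (simp add: scaleC_tensor.abs_eq tensor_lift_abs assms lin)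
  ultimately show ?thesis by (simp add: clinear_iff)
qed

lemma cbilinear_tensor_of: "cbilinear (\<otimes>)"
proof -
  have rel: "abs_tensor p = abs_tensor q" if "p - q \<in> tensor_relators"
    for p q :: "'a \<times> 'b \<Rightarrow>\<^sub>0 complex"
    using that by (simp add: tensor.abs_eq_iff tensor_rel_def complex_vector.span_base)
  show ?thesis
    unfolding cbilinear_iff tensor_of.abs_eq plus_tensor.abs_eq scaleC_tensor.abs_eq
    by (intro conjI allI rel; unfold tensor_relators_def diff_diff_eq[symmetric]; blast)
qed

lemmas tensor_of_bilinear = cbilinear_tensor_of[unfolded cbilinear_iff]

lemma tensor_induct [case_names zero add tensor_of]:
  assumes "P 0" "\<And>s t. P s \<Longrightarrow> P t \<Longrightarrow> P (s + t)" "\<And>u v. P (u \<otimes> v)"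
  shows "P t"
proof (induct t rule: tensor.abs_induct)
  fix p :: "'a \<times> 'b \<Rightarrow>\<^sub>0 complex"
  have *: "P (abs_tensor (Poly_Mapping.single k c))" for k c
  proof -
    have "abs_tensor (Poly_Mapping.single k c) = c *\<^sub>C (fst k \<otimes> snd k)"
    proof -
      have "Poly_Mapping.single k c = c *\<^sub>C Poly_Mapping.single k 1"
        by (rule poly_mapping_eqI) (simp add: lookup_scaleC lookup_single scaleC_complex_def when_def)
      then show ?thesis by (simp add: tensor_of.abs_eq scaleC_tensor.abs_eq)
    qed
    also have "\<dots> = (c *\<^sub>C fst k) \<otimes> snd k"
      by (simp add: tensor_of_bilinear)
    finally show ?thesis using assms(3) by simp
  qed
  have "P (abs_tensor (\<Sum>k\<in>S. Poly_Mapping.single k (Poly_Mapping.lookup p k)))" if "finite S" for S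
    using that
    by (induct S) (use assms(1,2) * in \<open>auto simp: zero_tensor_def[symmetric] plus_tensor.abs_eq[symmetric] zero_tensor.abs_eq[symmetric]\<close>)
  moreover have "(\<Sum>k\<in>Poly_Mapping.keys p. Poly_Mapping.single k (Poly_Mapping.lookup p k)) = p"
    by (rule poly_mapping_eqI) (simp add: lookup_sum lookup_single when_def in_keys_iff)
  ultimately show "P (abs_tensor p)"
    by (metis finite_keys)
qed

lemma clinear_tensor_eqI:
  assumes "clinear f" "clinear g" "\<And>u v. f (u \<otimes> v) = g (u \<otimes> v)"
  shows "f t = g t"
proof (induct t rule: tensor_induct)
  case zero
  show ?case by (simp add: assms clinear_0)
next
  case (add s t)
  then show ?case by (simp add: clinear_add[OF assms(1)] clinear_add[OF assms(2)])
qed (rule assms(3))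

definition tensor_map :: "('a::complex_vector \<Rightarrow> 'c::complex_vector) \<Rightarrow>
    ('b::complex_vector \<Rightarrow> 'd::complex_vector) \<Rightarrow> ('a, 'b) tensor \<Rightarrow> ('c, 'd) tensor"
  where "tensor_map f g = tensor_lift (\<lambda>u v. f u \<otimes> g v)"

definition tensor_swap :: "('a::complex_vector, 'b::complex_vector) tensor \<Rightarrow> ('b, 'a) tensor"
  where "tensor_swap = tensor_lift (\<lambda>u v. v \<otimes> u)"

text \<open>Triple tensor products are associated to the right.\<close>

definition tensor_cycle ::
    "('a::complex_vector, ('b::complex_vector, 'c::complex_vector) tensor) tensor
      \<Rightarrow> ('b, ('c, 'a) tensor) tensor"
  where "tensor_cycle = tensor_lift (\<lambda>u. tensor_lift (\<lambda>v w. v \<otimes> (w \<otimes> u)))"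

lemma cbilinear_tensor_map:
  assumes "clinear f" "clinear g" shows "cbilinear (\<lambda>u v. f u \<otimes> g v)"
  using assms by (simp add: cbilinear_iff clinear_iff tensor_of_bilinear)

lemma tensor_map_tensor_of:
  "clinear f \<Longrightarrow> clinear g \<Longrightarrow> tensor_map f g (u \<otimes> v) = f u \<otimes> g v"
  by (simp add: tensor_map_def tensor_lift_tensor_of cbilinear_tensor_map)

lemma clinear_tensor_map: "clinear f \<Longrightarrow> clinear g \<Longrightarrow> clinear (tensor_map f g)"
  by (simp add: tensor_map_def clinear_tensor_lift cbilinear_tensor_map)

lemma tensor_swap_tensor_of: "tensor_swap (u \<otimes> v) = v \<otimes> u"
  unfolding tensor_swap_def
  by (subst tensor_lift_tensor_of) (simp_all add: cbilinear_iff tensor_of_bilinear)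

lemma tensor_cycle_tensor_of:
  fixes u :: "'a::complex_vector" and v :: "'b::complex_vector" and w :: "'c::complex_vector"
  shows "tensor_cycle (u \<otimes> (v \<otimes> w)) = v \<otimes> (w \<otimes> u)"
proof -
  have inner: "cbilinear (\<lambda>v w. v \<otimes> (w \<otimes> u))" for u :: 'a
    by (simp add: cbilinear_iff tensor_of_bilinear)
  have lin: "clinear (tensor_lift (\<lambda>v w. v \<otimes> (w \<otimes> u)))" for u :: 'a
    by (rule clinear_tensor_lift[OF inner])
  have "tensor_lift (\<lambda>v w. v \<otimes> (w \<otimes> (u + u'))) t =
      tensor_lift (\<lambda>v w. v \<otimes> (w \<otimes> u)) t + tensor_lift (\<lambda>v w. v \<otimes> (w \<otimes> u')) t"
    for u u' :: 'a and t :: "('b, 'c) tensor"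
  proof (rule clinear_tensor_eqI[where t = t and f = "tensor_lift (\<lambda>v w. v \<otimes> (w \<otimes> (u + u')))"])
    show "clinear (\<lambda>t::('b, 'c) tensor. tensor_lift (\<lambda>v w. v \<otimes> (w \<otimes> u)) t
        + tensor_lift (\<lambda>v w. v \<otimes> (w \<otimes> u')) t)"
      unfolding clinear_iff
      by (simp add: clinear_add[OF lin] clinear_scale[OF lin] scaleC_add_right)
  qed (rule lin, simp only: tensor_lift_tensor_of[OF inner], simp only: tensor_of_bilinear)
  moreover have "tensor_lift (\<lambda>v w. v \<otimes> (w \<otimes> (c *\<^sub>C u))) t =
      c *\<^sub>C tensor_lift (\<lambda>v w. v \<otimes> (w \<otimes> u)) t"
    for c and u :: 'a and t :: "('b, 'c) tensor"
  proof (rule clinear_tensor_eqI[where t = t and f = "tensor_lift (\<lambda>v w. v \<otimes> (w \<otimes> (c *\<^sub>C u)))"])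
    show "clinear (\<lambda>t::('b, 'c) tensor. c *\<^sub>C tensor_lift (\<lambda>v w. v \<otimes> (w \<otimes> u)) t)"
      unfolding clinear_iff
      by (simp add: clinear_add[OF lin] clinear_scale[OF lin] scaleC_add_right scaleC_scaleC mult.commute)
  qed (rule lin, simp only: tensor_lift_tensor_of[OF inner], simp only: tensor_of_bilinear)
  ultimately have "cbilinear (\<lambda>u. tensor_lift (\<lambda>(v::'b) (w::'c). v \<otimes> (w \<otimes> (u::'a))))"
    unfolding cbilinear_def using lin by (auto simp: clinear_iff[of "\<lambda>u. tensor_lift (\<lambda>v w. v \<otimes> w \<otimes> u) t" for t])
  from tensor_lift_tensor_of[OF this] tensor_lift_tensor_of[OF inner] show ?thesis
    unfolding tensor_cycle_def by (rule trans)
qed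


section \<open>Lie algebras, Lie coalgebras and co-split Lie algebras\<close>

locale lie_algebra =
  fixes bracket :: "'a::complex_vector \<Rightarrow> 'a \<Rightarrow> 'a"
  assumes bilinear: "cbilinear bracket"
    and alternating: "bracket x x = 0"
    and jacobi: "bracket x (bracket y z) + bracket y (bracket z x) + bracket z (bracket x y) = 0"

locale lie_coalgebra =
  fixes \<delta> :: "'a::complex_vector \<Rightarrow> ('a, 'a) tensor"
  assumes colinear: "clinear \<delta>"
    and coantisymmetric: "\<delta> x + tensor_swap (\<delta> x) = 0"
    and cojacobi: "tensor_map id \<delta> (\<delta> x) + tensor_cycle (tensor_map id \<delta> (\<delta> x))
      + tensor_cycle (tensor_cycle (tensor_map id \<delta> (\<delta> x))) = 0"

locale co_split_lie_algebra = lie_algebra bracket + lie_coalgebra \<delta>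
  for bracket :: "'a::complex_vector \<Rightarrow> 'a \<Rightarrow> 'a" and \<delta> :: "'a \<Rightarrow> ('a, 'a) tensor" +
  assumes co_split: "tensor_lift bracket \<circ> \<delta> = id"


section \<open>The Lie algebra \<open>sl\<close>\<close>

typedef 'n sl = "{A :: complex ^ 'n ^ 'n. trace A = 0}"
  morphisms mat_of_sl sl_of_mat
  by (rule exI[of _ 0]) (simp add: trace_def)

setup_lifting type_definition_sl

instantiation sl :: (finite) complex_vector
begin
lift_definition zero_sl :: "'a sl" is 0 by (simp add: trace_def)
lift_definition plus_sl :: "'a sl \<Rightarrow> 'a sl \<Rightarrow> 'a sl" is "(+)" by (simp add: trace_add)
lift_definition minus_sl :: "'a sl \<Rightarrow> 'a sl \<Rightarrow> 'a sl" is "(-)" by (simp add: trace_sub)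
lift_definition uminus_sl :: "'a sl \<Rightarrow> 'a sl" is uminus by (simp add: trace_def sum_negf)
lift_definition scaleC_sl :: "complex \<Rightarrow> 'a sl \<Rightarrow> 'a sl" is scaleC
  by (simp add: trace_def scaleC_complex_def flip: sum_distrib_left)
instance
  by standard
    (simp_all add: mat_of_sl_inject[symmetric] zero_sl.rep_eq plus_sl.rep_eq minus_sl.rep_eq
      uminus_sl.rep_eq scaleC_sl.rep_eq scaleC_add_right scaleC_add_left scaleC_scaleC scaleC_one
      add.assoc add.commute)
end

lift_definition sl_bracket :: "'n::finite sl \<Rightarrow> 'n sl \<Rightarrow> 'n sl"
  is "\<lambda>A B. A ** B - B ** A"
  by (subst trace_sub, subst trace_mul_sym) simp

definition matrix_unit :: "'n \<Rightarrow> 'n \<Rightarrow> complex ^ 'n ^ 'n"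
  where "matrix_unit i j = (\<chi> a b. if a = i \<and> b = j then 1 else 0)"

text \<open>With \<open>CARD('n) = n + 1\<close> the factor is \<open>1 / (2 n + 2)\<close>.\<close>

definition delta_unit ::
    "'n::finite \<Rightarrow> 'n \<Rightarrow> (complex ^ 'n ^ 'n, complex ^ 'n ^ 'n) tensor"
  where "delta_unit i j = (1 / (2 * of_nat CARD('n))) *\<^sub>C
    (\<Sum>k\<in>UNIV. matrix_unit i k \<otimes> matrix_unit k j - matrix_unit k j \<otimes> matrix_unit i k)"

definition delta_gl ::
    "complex ^ 'n ^ 'n \<Rightarrow> (complex ^ 'n ^ 'n, complex ^ 'n ^ 'n) tensor"
  where "delta_gl A = (\<Sum>i\<in>UNIV. \<Sum>j\<in>UNIV. (A $ i $ j) *\<^sub>C delta_unit i j)"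

text \<open>
  The restriction of \<open>delta_gl\<close> to \<open>sl\<close> with values in \<open>sl \<otimes> sl\<close>, where \<open>sl \<otimes> sl\<close> is viewed
  inside \<open>gl \<otimes> gl\<close> along the inclusion; \<open>delta_sl_unique_ex\<close> shows that it is well defined.
\<close>

definition delta_sl :: "'n::finite sl \<Rightarrow> ('n sl, 'n sl) tensor"
  where "delta_sl A = (THE t. tensor_map mat_of_sl mat_of_sl t = delta_gl (mat_of_sl A))"

lemma clinear_delta_gl: "clinear delta_gl"
  by (simp add: clinear_iff delta_gl_def scaleC_add_left scaleC_complex_def
      complex_vector.scale_sum_right scaleC_scaleC sum.distrib)

lemma delta_gl_matrix_unit: "delta_gl (matrix_unit i j) = delta_unit i j"
proof -
  have "delta_gl (matrix_unit i j) =
      (\<Sum>a\<in>UNIV. \<Sum>b\<in>UNIV. if a = i then if b = j then delta_unit i j else 0 else 0)"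
    unfolding delta_gl_def matrix_unit_def
    by (intro sum.cong) (auto simp: complex_vector.scale_zero_left scaleC_one)
  also have "\<dots> = (\<Sum>a\<in>UNIV. if a = i then delta_unit i j else 0)"
    by (intro sum.cong) auto
  also have "\<dots> = delta_unit i j" by simp
  finally show ?thesis .
qed

lemma clinear_mat_of_sl: "clinear mat_of_sl"
  by (simp add: clinear_iff plus_sl.rep_eq scaleC_sl.rep_eq)

text \<open>The projection of \<open>gl\<close> onto \<open>sl\<close> along the scalar matrices.\<close>

lift_definition traceless_part :: "complex ^ 'n ^ 'n \<Rightarrow> 'n::finite sl"
  is "\<lambda>A. A - (trace A / of_nat CARD('n)) *\<^sub>C mat 1"
  by (simp add: trace_sub trace_def mat_def scaleC_complex_def sum_subtractf)

lemma clinear_traceless_part: "clinear (traceless_part :: complex ^ 'n ^ 'n \<Rightarrow> 'n::finite sl)"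
proof -
  have tr: "trace (c *\<^sub>C A) = c * trace A" for c and A :: "complex ^ 'n ^ 'n"
    by (simp add: trace_def scaleC_complex_def sum_distrib_left)
  have "mat_of_sl (traceless_part (A + B)) = mat_of_sl (traceless_part A + traceless_part B)"
    and "mat_of_sl (traceless_part (c *\<^sub>C A)) = mat_of_sl (c *\<^sub>C traceless_part A)"
    for c and A B :: "complex ^ 'n ^ 'n"
    by (simp_all add: traceless_part.rep_eq plus_sl.rep_eq scaleC_sl.rep_eq tr trace_add
        add_divide_distrib scaleC_add_left scaleC_scaleC complex_vector.scale_right_diff_distrib)
  then show ?thesis
    by (simp add: clinear_iff mat_of_sl_inject)
qed

lemma traceless_part_mat_of_sl [simp]: "traceless_part (mat_of_sl A) = A"
  by transfer (simp add: complex_vector.scale_zero_left)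

lemma tensor_map_compose:
  assumes "clinear f" "clinear g" "clinear f'" "clinear g'"
  shows "tensor_map f' g' (tensor_map f g t) = tensor_map (f' \<circ> f) (g' \<circ> g) t"
proof -
  note * = clinear_compose[OF assms(1,3)] clinear_compose[OF assms(2,4)]
  have "(tensor_map f' g' \<circ> tensor_map f g) t = tensor_map (f' \<circ> f) (g' \<circ> g) t"
    by (rule clinear_tensor_eqI[where f = "tensor_map f' g' \<circ> tensor_map f g"])
      (intro clinear_compose clinear_tensor_map assms, intro clinear_tensor_map *,
       simp only: o_apply[of "tensor_map f' g'"] tensor_map_tensor_of[OF *]
         tensor_map_tensor_of[OF assms(1,2)] tensor_map_tensor_of[OF assms(3,4)], simp)
  then show ?thesis by simp
qed

lemma tensor_map_id: "tensor_map (\<lambda>x. x) (\<lambda>x. x) t = t"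
  by (rule clinear_tensor_eqI[where g = "\<lambda>t. t"])
    (simp_all add: clinear_tensor_map tensor_map_tensor_of complex_vector.linear_ident)

lemma inj_tensor_map_mat_of_sl:
  "inj (tensor_map (mat_of_sl :: 'n::finite sl \<Rightarrow> _) (mat_of_sl :: 'n sl \<Rightarrow> _))"
proof (rule inj_on_inverseI)
  fix t :: "('n sl, 'n sl) tensor"
  show "tensor_map traceless_part traceless_part (tensor_map mat_of_sl mat_of_sl t) = t"
    by (simp add: tensor_map_compose clinear_mat_of_sl clinear_traceless_part o_def tensor_map_id)
qed

lemma delta_unit_traceless:
  "tensor_map mat_of_sl mat_of_sl (tensor_map traceless_part traceless_part (delta_unit i j))
     = delta_unit (i::'n::finite) j"
proof -
  let ?p = "mat_of_sl \<circ> (traceless_part :: complex ^ 'n ^ 'n \<Rightarrow> _)"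
  let ?E = "matrix_unit :: 'n \<Rightarrow> 'n \<Rightarrow> _"
  let ?c = "1 / of_nat CARD('n) :: complex"
  let ?I = "mat 1 :: complex ^ 'n ^ 'n"
  let ?d = "\<lambda>i j. if i = j then ?c else 0"
  have p: "clinear ?p"
    by (rule clinear_compose[OF clinear_traceless_part clinear_mat_of_sl])
  have tr: "trace (?E i j) = (if i = j then 1 else 0)" for i j
  proof -
    have "trace (?E i j) = (\<Sum>a\<in>UNIV. if a = i then if i = j then 1 else 0 else 0)"
      unfolding trace_def matrix_unit_def by (intro sum.cong) auto
    then show ?thesis by simp
  qed
  have pE: "?p (?E i j) = ?E i j - ?d i j *\<^sub>C ?I" for i j
    by (simp add: traceless_part.rep_eq tr)
  have bl: "(x - y) \<otimes> z = x \<otimes> z - y \<otimes> z" "z \<otimes> (x - y) = z \<otimes> x - z \<otimes> y"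
       "(a *\<^sub>C x) \<otimes> z = a *\<^sub>C (x \<otimes> z)" "z \<otimes> (a *\<^sub>C x) = a *\<^sub>C (z \<otimes> x)"
    for x y z :: "complex ^ 'n ^ 'n" and a
    using clinear_diff[where f = "\<lambda>x. x \<otimes> z"] clinear_diff[where f = "\<lambda>x. z \<otimes> x"]
    by (simp_all add: clinear_iff tensor_of_bilinear)
  have summand: "tensor_map ?p ?p (?E i k \<otimes> ?E k j - ?E k j \<otimes> ?E i k) =
      (?E i k \<otimes> ?E k j - ?E k j \<otimes> ?E i k)
      + ?d k j *\<^sub>C (?I \<otimes> ?E i k - ?E i k \<otimes> ?I)
      - ?d i k *\<^sub>C (?I \<otimes> ?E k j - ?E k j \<otimes> ?I)" for k
    by (simp add: clinear_diff[OF clinear_tensor_map[OF p p]] tensor_map_tensor_of[OF p p] pE bl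
        complex_vector.scale_right_diff_distrib scaleC_scaleC mult.commute algebra_simps del: o_apply)
  have s1: "(\<Sum>k\<in>UNIV. ?d k j *\<^sub>C (?I \<otimes> ?E i k - ?E i k \<otimes> ?I)) = ?c *\<^sub>C (?I \<otimes> ?E i j - ?E i j \<otimes> ?I)"
  proof -
    have "(\<Sum>k\<in>UNIV. ?d k j *\<^sub>C (?I \<otimes> ?E i k - ?E i k \<otimes> ?I)) =
       (\<Sum>k\<in>UNIV. if k = j then ?c *\<^sub>C (?I \<otimes> ?E i j - ?E i j \<otimes> ?I) else 0)"
      by (intro sum.cong) (auto simp: complex_vector.scale_zero_left)
    then show ?thesis by simp
  qed
  have s2: "(\<Sum>k\<in>UNIV. ?d i k *\<^sub>C (?I \<otimes> ?E k j - ?E k j \<otimes> ?I)) = ?c *\<^sub>C (?I \<otimes> ?E i j - ?E i j \<otimes> ?I)"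
  proof -
    have "(\<Sum>k\<in>UNIV. ?d i k *\<^sub>C (?I \<otimes> ?E k j - ?E k j \<otimes> ?I)) =
       (\<Sum>k\<in>UNIV. if k = i then ?c *\<^sub>C (?I \<otimes> ?E i j - ?E i j \<otimes> ?I) else 0)"
      by (intro sum.cong) (auto simp: complex_vector.scale_zero_left)
    then show ?thesis by simp
  qed
  have "(\<Sum>k\<in>UNIV. tensor_map ?p ?p (?E i k \<otimes> ?E k j - ?E k j \<otimes> ?E i k)) =
      (\<Sum>k\<in>UNIV. ?E i k \<otimes> ?E k j - ?E k j \<otimes> ?E i k)"
    unfolding summand sum.distrib sum_subtractf[of "\<lambda>k. _ k + _ k"] s1 s2 by simp
  then have "tensor_map ?p ?p (delta_unit i j) = delta_unit i j"
    unfolding delta_unit_def clinear_scale[OF clinear_tensor_map[OF p p]]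
      clinear_sum[OF clinear_tensor_map[OF p p]] by (rule arg_cong)
  then show ?thesis
    by (simp add: tensor_map_compose clinear_mat_of_sl clinear_traceless_part)
qed

lemma delta_sl_unique_ex:
  "\<exists>!t. tensor_map mat_of_sl mat_of_sl t = delta_gl (mat_of_sl (A :: 'n::finite sl))"
proof -
  let ?i = "tensor_map (mat_of_sl :: 'n sl \<Rightarrow> _) (mat_of_sl :: 'n sl \<Rightarrow> _)"
  let ?r = "tensor_map (traceless_part :: _ \<Rightarrow> 'n sl) (traceless_part :: _ \<Rightarrow> 'n sl)"
  note li = clinear_tensor_map[OF clinear_mat_of_sl clinear_mat_of_sl]
  note lr = clinear_tensor_map[OF clinear_traceless_part clinear_traceless_part]
  have "?i (?r (delta_gl (mat_of_sl A))) = delta_gl (mat_of_sl A)"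
    by (simp add: delta_gl_def clinear_scale[OF li] clinear_scale[OF lr] clinear_sum[OF li] clinear_sum[OF lr] delta_unit_traceless)
  then show ?thesis
    using inj_tensor_map_mat_of_sl by (metis injD)
qed

lemma tensor_map_delta_sl:
  "tensor_map mat_of_sl mat_of_sl (delta_sl A) = delta_gl (mat_of_sl A)"
  unfolding delta_sl_def by (rule theI'[OF delta_sl_unique_ex])

end

theory Submission
  imports Defs
begin

text \<open>
  Write \<open>N\<close> for the size of the matrices. The map \<open>\<Delta>(E\<^sub>i\<^sub>j) = \<Sum>\<^sub>k E\<^sub>i\<^sub>k \<otimes> E\<^sub>k\<^sub>j\<close> is the
  coassociative comultiplication dual to the matrix product, and \<open>\<delta>\<close> is \<open>1 / (2 N)\<close> times its
  co-commutator \<open>\<Delta> - \<tau> \<circ> \<Delta>\<close>. As the commutator of an associative product is a Lie bracket, so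
  the co-commutator of a coassociative coproduct is a Lie cobracket: co-antisymmetry is obvious
  (\<open>delta_gl_coantisymmetric\<close>), and the co-Jacobi identity holds because the four terms of the
  iterated co-commutator cancel in pairs when summed over the cyclic permutations of the three
  tensor factors (\<open>delta_gl_cojacobi\<close>).

  The composite of \<open>\<delta>\<close> with the bracket sends \<open>E\<^sub>i\<^sub>j\<close> to
  \<open>(1 / N) \<Sum>\<^sub>k [E\<^sub>i\<^sub>k, E\<^sub>k\<^sub>j]\<close>, which is \<open>E\<^sub>i\<^sub>j\<close> for \<open>i \<noteq> j\<close> and \<open>E\<^sub>i\<^sub>i - (1 / N) 1\<close> for
  \<open>i = j\<close>. On all matrices it is therefore not the
  identity but the projection onto \<open>sl\<close> along the scalar matrices
  (\<open>lift_commutator_delta_gl\<close>), and so it is the identity on \<open>sl\<close>.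

  All these identities are checked on matrix units, hence on \<open>gl\<close>. They descend to \<open>sl\<close> because
  the inclusion of \<open>sl\<close> into \<open>gl\<close> intertwines the cobrackets and its tensor square and cube are
  injective: it has the left inverse \<open>traceless_part\<close>, and tensor powers of a map with a linear
  left inverse again have one.
\<close>

section \<open>Linear maps on tensor products\<close>

text \<open>
  Partial lifting of a trilinear map. It is what makes maps defined on triple tensor products by
  nested lifting linear.
\<close>

lemma cbilinear_tensor_lift:
  fixes h :: "'a::complex_vector \<Rightarrow> 'b::complex_vector \<Rightarrow> 'c::complex_vector \<Rightarrow> 'd::complex_vector"
  assumes inner: "\<And>u. cbilinear (h u)" and outer: "\<And>v w. clinear (\<lambda>u. h u v w)"
  shows "cbilinear (\<lambda>u. tensor_lift (h u))"
proof -
  note lin = clinear_tensor_lift[OF inner]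
  have "tensor_lift (h (u + u')) t = tensor_lift (h u) t + tensor_lift (h u') t" for u u' t
  proof (rule clinear_tensor_eqI[where t = t])
    show "clinear (\<lambda>t. tensor_lift (h u) t + tensor_lift (h u') t)"
      by (simp add: clinear_iff clinear_add[OF lin] clinear_scale[OF lin] scaleC_add_right)
  qed (rule lin, simp only: tensor_lift_tensor_of[OF inner], rule clinear_add[OF outer])
  moreover have "tensor_lift (h (c *\<^sub>C u)) t = c *\<^sub>C tensor_lift (h u) t" for c u t
  proof (rule clinear_tensor_eqI[where t = t])
    show "clinear (\<lambda>t. c *\<^sub>C tensor_lift (h u) t)"
      by (simp add: clinear_iff clinear_add[OF lin] clinear_scale[OF lin] scaleC_add_right
          scaleC_scaleC mult.commute)
  qed (rule lin, simp only: tensor_lift_tensor_of[OF inner], rule clinear_scale[OF outer])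
  ultimately show ?thesis
    by (simp add: cbilinear_iff clinear_add[OF lin] clinear_scale[OF lin])
qed

lemma clinear_tensor_swap: "clinear tensor_swap"
  unfolding tensor_swap_def
  by (rule clinear_tensor_lift) (simp add: cbilinear_iff tensor_of_bilinear)

lemma clinear_tensor_cycle: "clinear tensor_cycle"
  unfolding tensor_cycle_def
  by (intro clinear_tensor_lift cbilinear_tensor_lift)
    (simp_all add: cbilinear_iff clinear_iff tensor_of_bilinear)

lemma tensor_of_diff:
  fixes u u' :: "'a::complex_vector" and v v' :: "'b::complex_vector"
  shows "(u - u') \<otimes> v = u \<otimes> v - u' \<otimes> v" "u \<otimes> (v - v') = u \<otimes> v - u \<otimes> v'"
  using clinear_diff[where f = "\<lambda>u. u \<otimes> v"] clinear_diff[where f = "\<lambda>v. u \<otimes> v"]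
  by (simp_all add: clinear_iff tensor_of_bilinear)

lemma tensor_of_sum_right: "u \<otimes> (\<Sum>i\<in>I. g i) = (\<Sum>i\<in>I. u \<otimes> g i)"
  using clinear_sum[where f = "\<lambda>v. u \<otimes> v"] by (simp add: clinear_iff tensor_of_bilinear)

lemma clinear_tensor3_eqI:
  fixes f g :: "('a::complex_vector, ('b::complex_vector, 'c::complex_vector) tensor) tensor
    \<Rightarrow> 'd::complex_vector"
  assumes f: "clinear f" and g: "clinear g"
    and eq: "\<And>u v w. f (u \<otimes> (v \<otimes> w)) = g (u \<otimes> (v \<otimes> w))"
  shows "f t = g t"
proof (rule clinear_tensor_eqI[OF f g])
  fix u s
  have "clinear (\<lambda>s. f (u \<otimes> s))" "clinear (\<lambda>s. g (u \<otimes> s))"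
    using f g by (simp_all add: clinear_iff tensor_of_bilinear)
  then show "f (u \<otimes> s) = g (u \<otimes> s)"
    by (rule clinear_tensor_eqI) (rule eq)
qed

lemma tensor_swap_natural:
  assumes f: "clinear f" and g: "clinear g"
  shows "tensor_map g f (tensor_swap t) = tensor_swap (tensor_map f g t)"
  by (rule clinear_tensor_eqI[where t = t and f = "\<lambda>t. tensor_map g f (tensor_swap t)"])
    (use clinear_compose[OF clinear_tensor_swap clinear_tensor_map[OF g f]]
      clinear_compose[OF clinear_tensor_map[OF f g] clinear_tensor_swap]
     in \<open>simp_all add: o_def tensor_swap_tensor_of tensor_map_tensor_of f g\<close>)

lemma tensor_cycle_natural:
  assumes f: "clinear f" and g: "clinear g" and h: "clinear h"
  shows "tensor_map g (tensor_map h f) (tensor_cycle t)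
    = tensor_cycle (tensor_map f (tensor_map g h) t)"
  by (rule clinear_tensor3_eqI[where t = t
        and f = "\<lambda>t. tensor_map g (tensor_map h f) (tensor_cycle t)"])
    (use clinear_compose[OF clinear_tensor_cycle clinear_tensor_map[OF g clinear_tensor_map[OF h f]]]
      clinear_compose[OF clinear_tensor_map[OF f clinear_tensor_map[OF g h]] clinear_tensor_cycle]
     in \<open>simp_all add: o_def tensor_cycle_tensor_of tensor_map_tensor_of clinear_tensor_map f g h\<close>)

lemma tensor_map_left_inverse:
  assumes "clinear f" "clinear f'" "clinear g" "clinear g'"
    and "\<And>x. f' (f x) = x" "\<And>y. g' (g y) = y"
  shows "tensor_map f' g' (tensor_map f g t) = t"
  using assms by (simp add: tensor_map_compose o_def tensor_map_id)


section \<open>The cobracket on all matrices\<close>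

lemma matrix_unit_expansion:
  "A = (\<Sum>i\<in>UNIV. \<Sum>j\<in>UNIV. (A $ i $ j) *\<^sub>C matrix_unit i (j :: 'n::finite))"
proof -
  have "(\<Sum>i\<in>UNIV. \<Sum>j\<in>UNIV. ((A $ i $ j) *\<^sub>C matrix_unit i j) $ a $ b) = A $ a $ b" for a b
  proof -
    have "(\<Sum>i\<in>UNIV. \<Sum>j\<in>UNIV. ((A $ i $ j) *\<^sub>C matrix_unit i j) $ a $ b) =
        (\<Sum>i\<in>UNIV. \<Sum>j\<in>UNIV. if j = b then if i = a then A $ a $ b else 0 else 0)"
      by (intro sum.cong) (auto simp: matrix_unit_def scaleC_complex_def)
    then show ?thesis by simp
  qed
  then show ?thesis by (simp add: vec_eq_iff)
qed

lemma clinear_matrix_eqI: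
  fixes f g :: "complex ^ 'n ^ 'n \<Rightarrow> 'a::complex_vector"
  assumes f: "clinear f" and g: "clinear g"
    and eq: "\<And>i j :: 'n::finite. f (matrix_unit i j) = g (matrix_unit i j)"
  shows "f A = g A"
  by (subst (1 2) matrix_unit_expansion)
    (simp add: clinear_sum[OF f] clinear_sum[OF g] clinear_scale[OF f] clinear_scale[OF g] eq)

lemma delta_gl_coantisymmetric: "delta_gl A + tensor_swap (delta_gl A) = 0"
proof (rule clinear_matrix_eqI[where f = "\<lambda>A. delta_gl A + tensor_swap (delta_gl A)"
      and g = "\<lambda>_. 0"])
  note \<delta> = clinear_delta_gl and \<tau> = clinear_tensor_swap
  show "clinear (\<lambda>A. delta_gl A + tensor_swap (delta_gl A))"
    by (simp add: clinear_iff clinear_add[OF \<delta>] clinear_scale[OF \<delta>] clinear_add[OF \<tau>]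
        clinear_scale[OF \<tau>] scaleC_add_right algebra_simps)
  show "delta_gl (matrix_unit i j) + tensor_swap (delta_gl (matrix_unit i j)) = 0" for i j
    by (simp add: delta_gl_matrix_unit delta_unit_def clinear_scale[OF \<tau>]
        clinear_sum[OF \<tau>] clinear_diff[OF \<tau>]
        tensor_swap_tensor_of flip: scaleC_add_right sum.distrib)
qed (simp add: clinear_iff)

text \<open>
  With \<open>a = E\<^sub>i\<^sub>k\<close>, \<open>b = E\<^sub>k\<^sub>l\<close>, \<open>c = E\<^sub>l\<^sub>j\<close> the summand is
  \<open>a \<otimes> (b \<otimes> c - c \<otimes> b) - c \<otimes> (a \<otimes> b - b \<otimes> a)\<close>. The first part comes from splitting the right
  factor of \<open>\<Delta>\<close>, the second from splitting the left one, and coassociativity is what lets both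
  double sums run over the same triples \<open>(a, b, c)\<close>.
\<close>

lemma iterated_delta_unit:
  fixes i j :: "'n::finite"
  shows "tensor_map id delta_gl (delta_unit i j) =
    (1 / (2 * of_nat CARD('n))\<^sup>2) *\<^sub>C (\<Sum>k\<in>UNIV. \<Sum>l\<in>UNIV.
      matrix_unit i k \<otimes> (matrix_unit k l \<otimes> matrix_unit l j)
      - matrix_unit i k \<otimes> (matrix_unit l j \<otimes> matrix_unit k l)
      - matrix_unit l j \<otimes> (matrix_unit i k \<otimes> matrix_unit k l)
      + matrix_unit l j \<otimes> (matrix_unit k l \<otimes> matrix_unit i k))"
proof -
  let ?E = "matrix_unit :: 'n \<Rightarrow> 'n \<Rightarrow> _"
  let ?c = "1 / (2 * of_nat CARD('n)) :: complex"
  have id: "clinear (id :: complex ^ 'n ^ 'n \<Rightarrow> _)" by (simp add: clinear_iff)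
  note lin = clinear_tensor_map[OF id clinear_delta_gl]
  let ?R = "\<lambda>k l. ?E i k \<otimes> (?E k l \<otimes> ?E l j) - ?E i k \<otimes> (?E l j \<otimes> ?E k l)"
  let ?L = "\<lambda>k l. ?E l j \<otimes> (?E i k \<otimes> ?E k l) - ?E l j \<otimes> (?E k l \<otimes> ?E i k)"
  have "tensor_map id delta_gl (delta_unit i j) =
      ?c *\<^sub>C (\<Sum>k\<in>UNIV. ?E i k \<otimes> delta_unit k j - ?E k j \<otimes> delta_unit i k)"
    unfolding delta_unit_def[of i j] clinear_scale[OF lin] clinear_sum[OF lin] clinear_diff[OF lin]
    by (simp add: tensor_map_tensor_of[OF id clinear_delta_gl] delta_gl_matrix_unit)
  also have "\<dots> = ?c *\<^sub>C ?c *\<^sub>C ((\<Sum>k\<in>UNIV. \<Sum>l\<in>UNIV. ?R k l) - (\<Sum>l\<in>UNIV. \<Sum>k\<in>UNIV. ?L k l))"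
    by (simp add: delta_unit_def tensor_of_bilinear tensor_of_sum_right tensor_of_diff
        complex_vector.scale_right_diff_distrib complex_vector.scale_sum_right sum_subtractf)
  also have "(\<Sum>l\<in>UNIV. \<Sum>k\<in>UNIV. ?L k l) = (\<Sum>k\<in>UNIV. \<Sum>l\<in>UNIV. ?L k l)"
    by (rule sum.swap)
  also have "(\<Sum>k\<in>UNIV. \<Sum>l\<in>UNIV. ?R k l) - \<dots> = (\<Sum>k\<in>UNIV. \<Sum>l\<in>UNIV.
      ?E i k \<otimes> (?E k l \<otimes> ?E l j) - ?E i k \<otimes> (?E l j \<otimes> ?E k l)
      - ?E l j \<otimes> (?E i k \<otimes> ?E k l) + ?E l j \<otimes> (?E k l \<otimes> ?E i k))"
    by (simp add: algebra_simps flip: sum_subtractf)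
  also have "?c *\<^sub>C ?c *\<^sub>C \<dots> = (1 / (2 * of_nat CARD('n))\<^sup>2) *\<^sub>C \<dots>"
    by (simp add: scaleC_scaleC power2_eq_square)
  finally show ?thesis .
qed

text \<open>
  In the notation just introduced, the summand is \<open>abc - acb - cab + cba\<close>. Here \<open>abc\<close> and \<open>cab\<close>
  are cyclic permutations of each other, and so are \<open>acb\<close> and \<open>cba\<close>; hence the sum over the
  three cyclic permutations vanishes for each \<open>(k, l)\<close> separately.
\<close>

lemma delta_gl_cojacobi:
  "tensor_map id delta_gl (delta_gl A) + tensor_cycle (tensor_map id delta_gl (delta_gl A))
    + tensor_cycle (tensor_cycle (tensor_map id delta_gl (delta_gl (A :: complex ^ 'n::finite ^ 'n)))) = 0"
proof (rule clinear_matrix_eqI[where A = A and g = "\<lambda>_. 0"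
      and f = "\<lambda>A. tensor_map id delta_gl (delta_gl A)
        + tensor_cycle (tensor_map id delta_gl (delta_gl A))
        + tensor_cycle (tensor_cycle (tensor_map id delta_gl (delta_gl A)))"])
  let ?\<xi> = "tensor_cycle :: (complex ^ 'n ^ 'n, (complex ^ 'n ^ 'n, complex ^ 'n ^ 'n) tensor) tensor \<Rightarrow> _"
  have id: "clinear (id :: complex ^ 'n ^ 'n \<Rightarrow> _)" by (simp add: clinear_iff)
  note \<delta> = clinear_delta_gl and cyc = clinear_tensor_cycle
  note \<delta>2 = clinear_tensor_map[OF id \<delta>]
  show "clinear (\<lambda>A::complex ^ 'n ^ 'n. tensor_map id delta_gl (delta_gl A)
        + ?\<xi> (tensor_map id delta_gl (delta_gl A)) + ?\<xi> (?\<xi> (tensor_map id delta_gl (delta_gl A))))"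
    by (simp add: clinear_iff clinear_add[OF \<delta>] clinear_scale[OF \<delta>] clinear_add[OF \<delta>2]
        clinear_scale[OF \<delta>2] clinear_add[OF cyc] clinear_scale[OF cyc] scaleC_add_right algebra_simps)
  fix i j :: 'n
  show "tensor_map id delta_gl (delta_gl (matrix_unit i j))
        + ?\<xi> (tensor_map id delta_gl (delta_gl (matrix_unit i j)))
        + ?\<xi> (?\<xi> (tensor_map id delta_gl (delta_gl (matrix_unit i j)))) = 0"
    unfolding delta_gl_matrix_unit iterated_delta_unit clinear_scale[OF cyc] clinear_sum[OF cyc]
      clinear_diff[OF cyc] clinear_add[OF cyc] tensor_cycle_tensor_of
      scaleC_add_right[symmetric] sum.distrib[symmetric]
    by (simp add: algebra_simps)
qed (simp add: clinear_iff)


section \<open>The commutator bracket\<close>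

lemma cbilinear_matrix_mult: "cbilinear ((**) :: complex ^ 'n ^ 'n \<Rightarrow> complex ^ 'n ^ 'n \<Rightarrow> _)"
  by (simp add: cbilinear_iff vec_eq_iff matrix_matrix_mult_def scaleC_complex_def
      sum_distrib_left sum.distrib algebra_simps)

lemma cbilinear_commutator:
  "cbilinear (\<lambda>A B :: complex ^ 'n ^ 'n. A ** B - B ** A)"
  using cbilinear_matrix_mult[where 'n = 'n]
  by (simp add: cbilinear_iff complex_vector.scale_right_diff_distrib)

lemma matrix_unit_mult:
  "matrix_unit i k ** matrix_unit l j = (if k = l then matrix_unit i (j :: 'n::finite) else 0)"
proof -
  have "(\<Sum>m\<in>UNIV. matrix_unit i k $ a $ m * matrix_unit l j $ m $ b) =
      (\<Sum>m\<in>UNIV. if m = k then if k = l \<and> a = i \<and> b = j then 1 else 0 else 0)" for a b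
    by (intro sum.cong) (auto simp: matrix_unit_def)
  then show ?thesis
    by (simp add: vec_eq_iff matrix_matrix_mult_def) (simp add: matrix_unit_def)
qed

lemma sum_matrix_unit_diag: "(\<Sum>k\<in>UNIV. matrix_unit k k) = (mat 1 :: complex ^ 'n::finite ^ 'n)"
proof -
  have "(\<Sum>k\<in>UNIV. matrix_unit k k $ a $ b) = (\<Sum>k\<in>UNIV. if k = a then if a = b then 1 else 0 else 0)"
    for a b :: 'n
    by (intro sum.cong) (auto simp: matrix_unit_def)
  then show ?thesis by (simp add: vec_eq_iff mat_def)
qed

lemma trace_matrix_unit: "trace (matrix_unit i j) = (if i = (j :: 'n::finite) then 1 else 0)"
proof -
  have "trace (matrix_unit i j) = (\<Sum>a\<in>UNIV. if a = i then if i = j then 1 else 0 else 0)"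
    unfolding trace_def matrix_unit_def by (intro sum.cong) auto
  then show ?thesis by simp
qed

text \<open>
  Both halves of the co-commutator contribute \<open>\<Sum>\<^sub>k [E\<^sub>i\<^sub>k, E\<^sub>k\<^sub>j]\<close>, which is \<open>N E\<^sub>i\<^sub>j\<close> up to a
  scalar matrix; the factor \<open>1 / (2 N)\<close> normalises the coefficient of \<open>E\<^sub>i\<^sub>j\<close> to one. The scalar
  matrix is then the one that makes the trace zero, as for any sum of commutators.
\<close>

lemma lift_commutator_delta_gl:
  "tensor_lift (\<lambda>A B. A ** B - B ** A) (delta_gl A) = mat_of_sl (traceless_part (A :: complex ^ 'n::finite ^ 'n))"
proof (rule clinear_matrix_eqI[where f = "\<lambda>A. tensor_lift (\<lambda>A B. A ** B - B ** A) (delta_gl A)"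
      and g = "\<lambda>A. mat_of_sl (traceless_part A)"])
  note lin = clinear_tensor_lift[OF cbilinear_commutator[where 'n = 'n]]
  show "clinear (\<lambda>A :: complex ^ 'n ^ 'n. tensor_lift (\<lambda>A B. A ** B - B ** A) (delta_gl A))"
    using clinear_compose[OF clinear_delta_gl lin] by (simp add: o_def)
  show "clinear (\<lambda>A :: complex ^ 'n ^ 'n. mat_of_sl (traceless_part A))"
    using clinear_compose[OF clinear_traceless_part clinear_mat_of_sl] by (simp add: o_def)
  fix i j :: 'n
  let ?E = "matrix_unit :: 'n \<Rightarrow> 'n \<Rightarrow> _"
  let ?N = "of_nat CARD('n) :: complex"
  let ?D = "if i = j then 1 else 0 :: complex"
  have const: "(\<Sum>k\<in>(UNIV :: 'n set). A) = ?N *\<^sub>C A" for A :: "complex ^ 'n ^ 'n"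
    by (simp add: vec_eq_iff scaleC_complex_def del: sum_constant) simp
  have comm: "?E i k ** ?E k j - ?E k j ** ?E i k = ?E i j - ?D *\<^sub>C ?E k k" for k
    by (simp add: matrix_unit_mult scaleC_one complex_vector.scale_zero_left)
  have "tensor_lift (\<lambda>A B. A ** B - B ** A) (delta_gl (?E i j)) =
      (1 / (2 * ?N)) *\<^sub>C (\<Sum>k\<in>UNIV. 2 *\<^sub>C (?E i k ** ?E k j - ?E k j ** ?E i k))"
    unfolding delta_gl_matrix_unit delta_unit_def clinear_scale[OF lin] clinear_sum[OF lin]
      clinear_diff[OF lin] tensor_lift_tensor_of[OF cbilinear_commutator]
    by (simp add: vec_eq_iff scaleC_complex_def)
  also have "\<dots> = (1 / (2 * ?N)) *\<^sub>C 2 *\<^sub>C (?N *\<^sub>C ?E i j - ?D *\<^sub>C mat 1)"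
    by (simp only: comm const sum_matrix_unit_diag sum_subtractf
        complex_vector.scale_sum_right[symmetric])
  also have "\<dots> = mat_of_sl (traceless_part (?E i j))"
    by (simp add: traceless_part.rep_eq trace_matrix_unit complex_vector.scale_right_diff_distrib
        scaleC_scaleC scaleC_one)
  finally show "tensor_lift (\<lambda>A B. A ** B - B ** A) (delta_gl (?E i j))
      = mat_of_sl (traceless_part (?E i j))" .
qed

lemma lie_algebra_sl: "lie_algebra (sl_bracket :: 'n::finite sl \<Rightarrow> 'n sl \<Rightarrow> 'n sl)"
proof
  show "cbilinear (sl_bracket :: 'n sl \<Rightarrow> 'n sl \<Rightarrow> 'n sl)"
    using cbilinear_commutator[where 'n = 'n]
    by (simp add: cbilinear_iff mat_of_sl_inject[symmetric] sl_bracket.rep_eq plus_sl.rep_eq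
        scaleC_sl.rep_eq)
  fix x y z :: "'n sl"
  show "sl_bracket x x = 0"
    by (simp add: mat_of_sl_inject[symmetric] sl_bracket.rep_eq zero_sl.rep_eq)
  have diff: "A ** (B - C) = A ** B - A ** C" "(B - C) ** A = B ** A - C ** A"
    for A B C :: "complex ^ 'n ^ 'n"
    using cbilinear_matrix_mult[where 'n = 'n]
    by (simp_all add: cbilinear_def clinear_diff[where f = "\<lambda>X. A ** X"]
        clinear_diff[where f = "\<lambda>X. X ** A"])
  show "sl_bracket x (sl_bracket y z) + sl_bracket y (sl_bracket z x)
      + sl_bracket z (sl_bracket x y) = 0"
    by (simp add: mat_of_sl_inject[symmetric] sl_bracket.rep_eq zero_sl.rep_eq plus_sl.rep_eq
        diff matrix_mul_assoc)
qed


section \<open>Descent to \<open>sl\<close>\<close>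

lemma clinear_delta_sl: "clinear (delta_sl :: 'n::finite sl \<Rightarrow> _)"
proof -
  note lin = clinear_tensor_map[OF clinear_mat_of_sl clinear_mat_of_sl]
  show ?thesis
    unfolding clinear_iff
    by (intro conjI allI injD[OF inj_tensor_map_mat_of_sl])
      (simp_all add: clinear_add[OF lin] clinear_scale[OF lin] tensor_map_delta_sl plus_sl.rep_eq
        scaleC_sl.rep_eq clinear_add[OF clinear_delta_gl] clinear_scale[OF clinear_delta_gl])
qed

lemma lie_coalgebra_sl: "lie_coalgebra (delta_sl :: 'n::finite sl \<Rightarrow> _)"
proof (rule lie_coalgebra.intro)
  show "clinear (delta_sl :: 'n sl \<Rightarrow> _)" by (rule clinear_delta_sl)
  fix x :: "'n sl"
  let ?\<iota> = "mat_of_sl :: 'n sl \<Rightarrow> _"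
  let ?\<pi> = "traceless_part :: _ \<Rightarrow> 'n sl"
  let ?\<iota>2 = "tensor_map ?\<iota> ?\<iota>"
  let ?\<iota>3 = "tensor_map ?\<iota> ?\<iota>2"
  note \<iota> = clinear_mat_of_sl
  note \<iota>2 = clinear_tensor_map[OF \<iota> \<iota>] and \<pi>2 = clinear_tensor_map[OF clinear_traceless_part clinear_traceless_part]
  note \<iota>3 = clinear_tensor_map[OF \<iota> \<iota>2]
  have "?\<iota>2 (delta_sl x + tensor_swap (delta_sl x)) = ?\<iota>2 0"
    by (simp add: clinear_add[OF \<iota>2] clinear_0[OF \<iota>2] tensor_swap_natural[OF \<iota> \<iota>]
        tensor_map_delta_sl delta_gl_coantisymmetric)
  then show "delta_sl x + tensor_swap (delta_sl x) = 0"
    by (rule injD[OF inj_tensor_map_mat_of_sl])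
  have inj3: "inj ?\<iota>3"
    by (rule inj_on_inverseI[where g = "tensor_map ?\<pi> (tensor_map ?\<pi> ?\<pi>)"])
      (intro tensor_map_left_inverse \<iota> \<iota>2 \<pi>2 clinear_traceless_part traceless_part_mat_of_sl)
  have id: "clinear (id :: 'a::complex_vector \<Rightarrow> 'a)" by (simp add: clinear_iff)
  have "?\<iota>3 (tensor_map id delta_sl t) = tensor_map id delta_gl (?\<iota>2 t)" for t
    by (simp add: tensor_map_compose id \<iota> \<iota>2 clinear_delta_sl clinear_delta_gl o_def
        tensor_map_delta_sl)
  then have \<delta>2: "?\<iota>3 (tensor_map id delta_sl (delta_sl x)) = tensor_map id delta_gl (delta_gl (?\<iota> x))"
    by (simp add: tensor_map_delta_sl)
  have "?\<iota>3 (tensor_map id delta_sl (delta_sl x) + tensor_cycle (tensor_map id delta_sl (delta_sl x))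
      + tensor_cycle (tensor_cycle (tensor_map id delta_sl (delta_sl x)))) = ?\<iota>3 0"
    by (simp add: clinear_add[OF \<iota>3] clinear_0[OF \<iota>3] tensor_cycle_natural[OF \<iota> \<iota> \<iota>] \<delta>2
        delta_gl_cojacobi)
  then show "tensor_map id delta_sl (delta_sl x) + tensor_cycle (tensor_map id delta_sl (delta_sl x))
      + tensor_cycle (tensor_cycle (tensor_map id delta_sl (delta_sl x))) = 0"
    by (rule injD[OF inj3])
qed

lemma mat_of_sl_lift_bracket:
  "mat_of_sl (tensor_lift sl_bracket t) =
    tensor_lift (\<lambda>A B. A ** B - B ** A) (tensor_map mat_of_sl mat_of_sl (t :: ('n::finite sl, 'n sl) tensor))"
proof (rule clinear_tensor_eqI[where t = t])
  note \<iota> = clinear_mat_of_sl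
  note bil = lie_algebra.bilinear[OF lie_algebra_sl]
  show "clinear (\<lambda>t :: ('n sl, 'n sl) tensor. mat_of_sl (tensor_lift sl_bracket t))"
    using clinear_compose[OF clinear_tensor_lift[OF bil] \<iota>] by (simp add: o_def)
  show "clinear (\<lambda>t :: ('n sl, 'n sl) tensor.
      tensor_lift (\<lambda>A B. A ** B - B ** A) (tensor_map mat_of_sl mat_of_sl t))"
    using clinear_compose[OF clinear_tensor_map[OF \<iota> \<iota>] clinear_tensor_lift[OF cbilinear_commutator]]
    by (simp add: o_def)
  show "mat_of_sl (tensor_lift sl_bracket (u \<otimes> v)) =
      tensor_lift (\<lambda>A B. A ** B - B ** A) (tensor_map mat_of_sl mat_of_sl (u \<otimes> v))" for u v :: "'n sl"
    by (simp add: tensor_lift_tensor_of[OF bil] tensor_map_tensor_of[OF \<iota> \<iota>]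
        tensor_lift_tensor_of[OF cbilinear_commutator] sl_bracket.rep_eq)
qed

theorem theorem4p2:
  fixes n :: nat
  assumes "n \<ge> 1"
    and "CARD('n::finite) = n + 1"
  shows "co_split_lie_algebra
    (sl_bracket :: 'n sl \<Rightarrow> 'n sl \<Rightarrow> 'n sl)
    (delta_sl :: 'n sl \<Rightarrow> ('n sl, 'n sl) tensor)"
proof (intro co_split_lie_algebra.intro lie_algebra_sl lie_coalgebra_sl
    co_split_lie_algebra_axioms.intro)
  have "mat_of_sl (tensor_lift sl_bracket (delta_sl A)) = mat_of_sl A" for A :: "'n sl"
    by (simp add: mat_of_sl_lift_bracket tensor_map_delta_sl lift_commutator_delta_gl)
  then show "tensor_lift sl_bracket \<circ> (delta_sl :: 'n sl \<Rightarrow> _) = id"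
    by (simp add: fun_eq_iff mat_of_sl_inject)
qed

end
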